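(* Let $K$ be a field of characteristic zero and $q\in K^\times$. Let $Q_q(K)$ be the quantum plane with multiplication $\cdot_0$, and let $Q_q^k(K)=(Q_q(K),*,\alpha_k)$ be the hom-associative quantum plane, where $\alpha_k(y^mx^n)=k^my^mx^n$ and $a*b=\alpha_k(a\cdot_0 b)$. Then the deformation of $Q_q(K)$ into $Q_q^k(K)$ (with parameter $t:=k-1$ regarded as an indeterminate) induces a one-parameter formal hom-Lie deformation of the Lie algebra of $Q_q(K)$ into the hom-Lie algebra of $Q_q^k(K)$, using the commutator as bracket. Explicitly: let $\alpha_t$ be the $K\llbracket t\rrbracket$-linear map on $Q_q(K)\llbracket t\rrbracket$ and $\cdot_t$ the $K\llbracket t\rrbracket$-bilinear operation on $Q_q(K)\llbracket t\rrbracket$ obtained from $\alpha_k$ and $*$ by substituting $k=1+t$. That is, $\alpha_t(y^mx^n)=(1+t)^my^mx^n$ for all $m,n\in\mathbb{N}_0$ and $a\cdot_t b=\alpha_t(a\cdot_0 b)$ for all $a,b\in Q_q(K)$, both extended homogeneously. Let $[a,b]_t:=a\cdot_t b-b\cdot_t a$ for $a,b\in Q_q(K)\llbracket t\rrbracket$, and let $[a,b]_0:=a\cdot_0 b-b\cdot_0 a$ for $a,b\in Q_q(K)$. Then $(Q_q(K)\llbracket t\rrbracket,[\cdot,\cdot]_t,\alpha_t)$ is a one-parameter formal hom-Lie deformation of the Lie algebra $(Q_q(K),[\cdot,\cdot]_0,\mathrm{id}_{Q_q(K)})$ over $K$.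
   Context: **Hom-Lie algebras.** A hom-Lie algebra over an associative, commutative, unital ring $R$ is a triple $(M,[\cdot,\cdot],\alpha)$ where $M$ is an $R$-module, $\alpha\colon M\to M$ is an $R$-linear map (the twisting map), and $[\cdot,\cdot]\colon M\times M\to M$ is an $R$-bilinear map with $[u,u]=0$ for all $u\in M$ and $[\alpha(u),[v,w]]+[\alpha(w),[u,v]]+[\alpha(v),[w,u]]=0$ for all $u,v,w\in M$ (hom-Jacobi identity). A Lie algebra is regarded as a hom-Lie algebra with twisting map the identity. **Hom-associative algebras and commutators.** A hom-associative algebra over $R$ is a triple $(M,\cdot,\alpha)$ with $M$ an $R$-module, $\cdot$ an $R$-bilinear operation on $M$ and $\alpha\colon M\to M$ an $R$-linear map such that $\alpha(a)\cdot(b\cdot c)=(a\cdot b)\cdot\alpha(c)$ for all $a,b,c\in M$. Its (hom-)Lie algebra is $(M,[\cdot,\cdot],\alpha)$ with $[a,b]=a\cdot b-b\cdot a$. **Power series and homogeneous extension.** For an $R$-module $M$, $M\llbracket t\rrbracket$ denotes the $R\llbracket t\rrbracket$-module of formal power series $\sum_{j\ge 0}m_jt^j$ with $m_j\in M$. An $R$-linear map $f\colon M\to M$ is extended homogeneously to $M\llbracket t\rrbracket$ by $f(\sum_j m_jt^j)=\sum_j f(m_j)t^j$. An $R$-bilinear operation $\star$ on $M$ is extended homogeneously by $(\sum_j m_jt^j)\star(\sum_l n_lt^l)=\sum_{j,l}(m_j\star n_l)t^{j+l}$. If $\alpha_i$ ($i\in\mathbb{N}_0$) are $R$-linear maps $M\to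 M$, then $\sum_{i}\alpha_it^i$ denotes the $R\llbracket t\rrbracket$-linear map on $M\llbracket t\rrbracket$ given by $u\mapsto\sum_i\alpha_i(u)t^i$, and similarly for a sequence of bilinear operations. An $R$-linear map $M\to M\llbracket t\rrbracket$, $m\mapsto\sum_i\alpha_i(m)t^i$, is thus extended homogeneously to $M\llbracket t\rrbracket$ by extending each $\alpha_i$, and similarly for bilinear maps. **One-parameter formal hom-Lie deformation.** A one-parameter formal hom-Lie deformation of a hom-Lie algebra $(M,[\cdot,\cdot]_0,\alpha_0)$ over $R$ is a hom-Lie algebra $(M\llbracket t\rrbracket,[\cdot,\cdot]_t,\alpha_t)$ over $R\llbracket t\rrbracket$ with $[\cdot,\cdot]_t=\sum_{i=0}^\infty[\cdot,\cdot]_i\,t^i$ and $\alpha_t=\sum_{i=0}^\infty\alpha_it^i$. Here each $[\cdot,\cdot]_i\colon M\times M\to M$ is an $R$-bilinear operation and each $\alpha_i\colon M\to M$ is an $R$-linear map, all extended homogeneously to $M\llbracket t\rrbracket$, and the $i=0$ terms are the given $[\cdot,\cdot]_0$ and $\alpha_0$. **Quantum planes.** $Q_q(K)$ is the unital associative $K$-algebra $K\langle x,y\rangle/(xy-q\,yx)$. Equivalently, it is the Ore extension $K[y][x;\sigma,0]$ with $\sigma(y)=qy$. It has $K$-basis $\{y^mx^n: m,n\in\mathbb{N}_0\}$. For $k\in K^\times$, $\alpha_k$ is the $K$-linear map on $Q_q(K)$ with $\alpha_k(y^mx^n)=k^my^mx^n$, and $Q_q^k(K)$ is the hom-associative algebra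 $(Q_q(K),*,\alpha_k)$ with $a*b:=\alpha_k(a\cdot_0 b)$. "The deformation of $Q_q(K)$ into $Q_q^k(K)$" means the triple $(Q_q(K)\llbracket t\rrbracket,\cdot_t,\alpha_t)$ obtained by substituting $k=1+t$. *)

theory Defs
  imports "HOL-Computational_Algebra.Computational_Algebra"
begin

section \<open>Hom-Lie algebras\<close>

definition module_bilinear :: "('r::comm_ring_1 \<Rightarrow> 'm::ab_group_add \<Rightarrow> 'm) \<Rightarrow> ('m \<Rightarrow> 'm \<Rightarrow> 'm) \<Rightarrow> bool"
  where "module_bilinear s f \<longleftrightarrow>
    (\<forall>u. module_hom s s (\<lambda>v. f u v)) \<and> (\<forall>v. module_hom s s (\<lambda>u. f u v))"

locale hom_lie_algebra = module scale
  for scale :: "'r::comm_ring_1 \<Rightarrow> 'm::ab_group_add \<Rightarrow> 'm" +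
  fixes bracket :: "'m \<Rightarrow> 'm \<Rightarrow> 'm" and twist :: "'m \<Rightarrow> 'm"
  assumes twist_linear: "module_hom scale scale twist"
    and bracket_bilinear: "module_bilinear scale bracket"
    and bracket_self: "bracket u u = 0"
    and hom_jacobi: "bracket (twist u) (bracket v w) + bracket (twist w) (bracket u v)
      + bracket (twist v) (bracket w u) = 0"

definition commutator :: "('m::ab_group_add \<Rightarrow> 'm \<Rightarrow> 'm) \<Rightarrow> 'm \<Rightarrow> 'm \<Rightarrow> 'm"
  where "commutator f a b = f a b - f b a"


section \<open>Power series with coefficients in a module, and formal deformations\<close>

text \<open>
  For an \<open>R\<close>-module \<open>M\<close> of type \<open>'m\<close>, the type \<open>'m fps\<close> is used as the additive group \<open>M[[t]]\<close>.
  A multiplication that \<open>'m\<close> may carry as a type plays no role; the action of \<open>R[[t]]\<close>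
  and the products on \<open>M[[t]]\<close> are the ones defined below.
\<close>

definition fps_scale :: "('r::comm_ring_1 \<Rightarrow> 'm::ab_group_add \<Rightarrow> 'm) \<Rightarrow> 'r fps \<Rightarrow> 'm fps \<Rightarrow> 'm fps"
  where "fps_scale s c u = Abs_fps (\<lambda>n. \<Sum>j\<le>n. s (fps_nth c j) (fps_nth u (n - j)))"

definition fps_hom_ext :: "('m::ab_group_add \<Rightarrow> 'm) \<Rightarrow> 'm fps \<Rightarrow> 'm fps"
  where "fps_hom_ext f u = Abs_fps (\<lambda>n. f (fps_nth u n))"

definition fps_hom_ext2 :: "('m::ab_group_add \<Rightarrow> 'm \<Rightarrow> 'm) \<Rightarrow> 'm fps \<Rightarrow> 'm fps \<Rightarrow> 'm fps"
  where "fps_hom_ext2 f u v = Abs_fps (\<lambda>n. \<Sum>j\<le>n. f (fps_nth u j) (fps_nth v (n - j)))"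

text \<open>The maps \<open>\<Sum>i. f i * t ^ i\<close> on \<open>M[[t]]\<close>, where each \<open>f i\<close> is extended homogeneously.\<close>

definition fps_series :: "(nat \<Rightarrow> 'm::ab_group_add \<Rightarrow> 'm) \<Rightarrow> 'm fps \<Rightarrow> 'm fps"
  where "fps_series f u = Abs_fps (\<lambda>n. \<Sum>i\<le>n. fps_nth (fps_hom_ext (f i) u) (n - i))"

definition fps_series2 :: "(nat \<Rightarrow> 'm::ab_group_add \<Rightarrow> 'm \<Rightarrow> 'm) \<Rightarrow> 'm fps \<Rightarrow> 'm fps \<Rightarrow> 'm fps"
  where "fps_series2 f u v = Abs_fps (\<lambda>n. \<Sum>i\<le>n. fps_nth (fps_hom_ext2 (f i) u v) (n - i))"

text \<open>Homogeneous extension of maps \<open>M \<Rightarrow> M[[t]]\<close> and \<open>M \<Rightarrow> M \<Rightarrow> M[[t]]\<close>.\<close>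

definition fps_lift :: "('m::ab_group_add \<Rightarrow> 'm fps) \<Rightarrow> 'm fps \<Rightarrow> 'm fps"
  where "fps_lift f = fps_series (\<lambda>i a. fps_nth (f a) i)"

definition fps_lift2 :: "('m::ab_group_add \<Rightarrow> 'm \<Rightarrow> 'm fps) \<Rightarrow> 'm fps \<Rightarrow> 'm fps \<Rightarrow> 'm fps"
  where "fps_lift2 f = fps_series2 (\<lambda>i a b. fps_nth (f a b) i)"

definition formal_hom_lie_deformation ::
    "('r::comm_ring_1 \<Rightarrow> 'm::ab_group_add \<Rightarrow> 'm) \<Rightarrow> ('m \<Rightarrow> 'm \<Rightarrow> 'm) \<Rightarrow> ('m \<Rightarrow> 'm)
      \<Rightarrow> ('m fps \<Rightarrow> 'm fps \<Rightarrow> 'm fps) \<Rightarrow> ('m fps \<Rightarrow> 'm fps) \<Rightarrow> bool"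
  where "formal_hom_lie_deformation s br0 tw0 brt twt \<longleftrightarrow>
    hom_lie_algebra s br0 tw0 \<and>
    hom_lie_algebra (fps_scale s) brt twt \<and>
    (\<exists>br. (\<forall>i. module_bilinear s (br i)) \<and> br 0 = br0 \<and> brt = fps_series2 br) \<and>
    (\<exists>tw. (\<forall>i. module_hom s s (tw i)) \<and> tw 0 = tw0 \<and> twt = fps_series tw)"


section \<open>The quantum plane and its hom-associative version\<close>

text \<open>
  The Ore extension \<open>A[x; \<sigma>, 0]\<close>: an element of \<open>'a poly\<close> is a polynomial in \<open>x\<close> with
  coefficients written on the left, and multiplication is determined by \<open>x * r = \<sigma> r * x\<close>.
\<close>

definition ore_mult :: "('a::comm_ring_1 \<Rightarrow> 'a) \<Rightarrow> 'a poly \<Rightarrow> 'a poly \<Rightarrow> 'a poly"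
  where "ore_mult \<sigma> a b =
    (\<Sum>i\<le>degree a. \<Sum>j\<le>degree b. monom (coeff a i * (\<sigma> ^^ i) (coeff b j)) (i + j))"

text \<open>
  The quantum plane \<open>K[y][x; \<sigma>, 0]\<close> with \<open>\<sigma> y = q * y\<close> lives on the type \<open>'k poly poly\<close>:
  the inner polynomials are in \<open>y\<close>, the outer ones in \<open>x\<close>.
\<close>

definition qp_mult :: "'k::field \<Rightarrow> 'k poly poly \<Rightarrow> 'k poly poly \<Rightarrow> 'k poly poly"
  where "qp_mult q = ore_mult (\<lambda>p. pcompose p [:0, q:])"

definition qp_scale :: "'k::field \<Rightarrow> 'k poly poly \<Rightarrow> 'k poly poly"
  where "qp_scale c a = smult [:c:] a"

text \<open>The basis element \<open>y ^ m * x ^ n\<close>.\<close>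

definition qp_basis :: "nat \<Rightarrow> nat \<Rightarrow> 'k::field poly poly"
  where "qp_basis m n = monom (monom 1 m) n"

text \<open>
  The \<open>K\<close>-linear map sending \<open>y ^ m * x ^ n\<close> to \<open>k ^ m * (y ^ m * x ^ n)\<close>, where the scalar \<open>k\<close>
  may be taken from a commutative \<open>K\<close>-algebra \<open>R\<close> (with structure map \<open>\<iota>\<close>), and the values lie in
  an \<open>R\<close>-module (with action \<open>s\<close>) that receives the quantum plane through \<open>\<kappa>\<close>.
  For \<open>R = K\<close> it is the twisting map for \<open>k\<close> in \<open>K\<close>; for \<open>R = K[[t]]\<close> one can substitute
  \<open>k = 1 + t\<close>.
\<close>

definition qp_twist_gen :: "('r::comm_ring_1 \<Rightarrow> 'm::ab_group_add \<Rightarrow> 'm) \<Rightarrow> ('k::field \<Rightarrow> 'r)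
    \<Rightarrow> ('k poly poly \<Rightarrow> 'm) \<Rightarrow> 'r \<Rightarrow> 'k poly poly \<Rightarrow> 'm"
  where "qp_twist_gen s \<iota> \<kappa> k a =
    (\<Sum>n\<le>degree a. \<Sum>m\<le>degree (coeff a n).
       s (\<iota> (coeff (coeff a n) m)) (s (k ^ m) (\<kappa> (qp_basis m n))))"

definition qp_twist :: "'k::field \<Rightarrow> 'k poly poly \<Rightarrow> 'k poly poly"
  where "qp_twist k = qp_twist_gen qp_scale (\<lambda>c. c) (\<lambda>a. a) k"

definition hqp_mult :: "'k::field \<Rightarrow> 'k \<Rightarrow> 'k poly poly \<Rightarrow> 'k poly poly \<Rightarrow> 'k poly poly"
  where "hqp_mult q k a b = qp_twist k (qp_mult q a b)"

text \<open>The same maps for \<open>k = 1 + t\<close>, first on the quantum plane, then on its power series.\<close>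

definition qp_twist_t0 :: "'k::field poly poly \<Rightarrow> 'k poly poly fps"
  where "qp_twist_t0 = qp_twist_gen (fps_scale qp_scale) fps_const fps_const (1 + fps_X)"

definition qp_twist_t :: "'k::field poly poly fps \<Rightarrow> 'k poly poly fps"
  where "qp_twist_t = fps_lift qp_twist_t0"

definition hqp_mult_t :: "'k::field \<Rightarrow> 'k poly poly fps \<Rightarrow> 'k poly poly fps \<Rightarrow> 'k poly poly fps"
  where "hqp_mult_t q = fps_lift2 (\<lambda>a b. qp_twist_t0 (qp_mult q a b))"


section \<open>Consistency checks\<close>

lemma qp_pcompose_monom: "pcompose (monom d m) [:0, q:] = monom (d * q ^ m) m"
  for q d :: "'k::field"
proof -
  have "pcompose (monom 1 1 ^ m) [:0, q:] = [:0, q:] ^ m"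
    by (induction m) (simp_all add: pcompose_1 pcompose_mult pcompose_pCons monom_altdef)
  moreover have "[:0, q:] = monom q 1" by (simp add: monom_altdef)
  ultimately have "pcompose (monom 1 m) [:0, q:] = monom (q ^ m) m"
    by (simp add: monom_power)
  then have "pcompose (smult d (monom 1 m)) [:0, q:] = monom (d * q ^ m) m"
    unfolding pcompose_smult by (simp add: smult_monom)
  then show ?thesis by (simp add: smult_monom)
qed

lemma qp_pcompose_iter_monom:
  "((\<lambda>p. pcompose p [:0, q:]) ^^ i) (monom c m) = monom (c * q ^ (i * m)) m"
  for q c :: "'k::field"
  by (induction i) (simp_all add: qp_pcompose_monom power_add mult_ac)

lemma ore_mult_monom:
  assumes "\<sigma> 0 = 0"
  shows "ore_mult \<sigma> (monom a i) (monom b j) = monom (a * (\<sigma> ^^ i) b) (i + j)"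
proof -
  have z: "(\<sigma> ^^ l) 0 = 0" for l by (induction l) (simp_all add: assms)
  show ?thesis
  proof (cases "a = 0 \<or> b = 0")
    case True
    then show ?thesis by (auto simp: ore_mult_def z)
  next
    case False
    then have d: "degree (monom a i) = i" "degree (monom b j) = j"
      by (simp_all add: degree_monom_eq)
    have "ore_mult \<sigma> (monom a i) (monom b j) =
      (\<Sum>i'\<le>i. \<Sum>j'\<le>j. if i' = i \<and> j' = j then monom (a * (\<sigma> ^^ i) b) (i + j) else 0)"
      unfolding ore_mult_def d by (intro sum.cong refl) (auto simp: z)
    also have "\<dots> = (\<Sum>i'\<le>i. if i' = i then monom (a * (\<sigma> ^^ i) b) (i + j) else 0)"
      by (intro sum.cong refl) (auto simp: sum.delta)
    finally show ?thesis by simp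
  qed
qed

lemma qp_mult_basis:
  "qp_mult q (qp_basis m n) (qp_basis m' n') = qp_scale (q ^ (n * m')) (qp_basis (m + m') (n + n'))"
  by (simp add: qp_mult_def qp_basis_def ore_mult_monom qp_pcompose_iter_monom mult_monom
      qp_scale_def smult_monom)

text \<open>The defining relation \<open>x * y = q * (y * x)\<close>.\<close>

lemma qp_relation:
  "qp_mult q (qp_basis 0 1) (qp_basis 1 0) = qp_scale q (qp_mult q (qp_basis 1 0) (qp_basis 0 1))"
  unfolding qp_mult_basis by (simp add: qp_scale_def)

lemma qp_twist_gen_basis:
  fixes \<iota> :: "'k::field \<Rightarrow> 'r::comm_ring_1"
  assumes "\<iota> 0 = 0" "\<iota> 1 = 1" "\<And>v. s 0 v = 0" "\<And>v. s 1 v = v"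
  shows "qp_twist_gen s \<iota> \<kappa> k (qp_basis m n) = s (k ^ m) (\<kappa> (qp_basis m n))"
proof -
  define b where "b = (qp_basis m n :: 'k poly poly)"
  have c: "coeff (coeff b n') m' = (if n' = n \<and> m' = m then 1 else 0)" for n' m'
    by (simp add: b_def qp_basis_def)
  have d: "degree b = n" "degree (coeff b n) = m"
    by (simp_all add: b_def qp_basis_def degree_monom_eq)
  have "qp_twist_gen s \<iota> \<kappa> k b = (\<Sum>n'\<le>n. \<Sum>m'\<le>degree (coeff b n').
      if n' = n \<and> m' = m then s (k ^ m) (\<kappa> b) else 0)"
    unfolding qp_twist_gen_def d(1) c by (intro sum.cong refl) (auto simp: assms b_def)
  also have "\<dots> = (\<Sum>n'\<le>n. if n' = n then s (k ^ m) (\<kappa> b) else 0)"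
    by (intro sum.cong refl) (auto simp: sum.delta d)
  finally show ?thesis by (simp add: b_def)
qed

lemma qp_twist_basis: "qp_twist k (qp_basis m n) = qp_scale (k ^ m) (qp_basis m n)"
  unfolding qp_twist_def
  by (rule qp_twist_gen_basis) (simp_all add: qp_scale_def flip: one_pCons)

lemma qp_fps_scale_0: "fps_scale qp_scale 0 v = 0"
  by (rule fps_ext) (simp add: fps_scale_def qp_scale_def)

lemma qp_fps_scale_1: "fps_scale qp_scale 1 v = v"
proof (rule fps_ext)
  fix n
  have "fps_nth (fps_scale qp_scale 1 v) n = (\<Sum>j\<le>n. if j = 0 then fps_nth v n else 0)"
    unfolding fps_scale_def fps_nth_Abs_fps
    by (intro sum.cong refl) (auto simp: qp_scale_def simp flip: one_pCons)
  then show "fps_nth (fps_scale qp_scale 1 v) n = fps_nth v n" by simp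
qed

lemma fps_lift_const:
  assumes "f 0 = 0"
  shows "fps_lift f (fps_const a) = f a"
proof (rule fps_ext)
  fix n
  have "fps_nth (fps_lift f (fps_const a)) n = (\<Sum>i\<le>n. if i = n then fps_nth (f a) n else 0)"
    unfolding fps_lift_def fps_series_def fps_hom_ext_def fps_nth_Abs_fps
    by (intro sum.cong refl) (auto simp: assms)
  then show "fps_nth (fps_lift f (fps_const a)) n = fps_nth (f a) n" by simp
qed

lemma fps_lift2_const:
  assumes "\<And>b. f 0 b = 0" "\<And>a. f a 0 = 0"
  shows "fps_lift2 f (fps_const a) (fps_const b) = f a b"
proof (rule fps_ext)
  fix n
  have *: "(\<Sum>j\<le>l. fps_nth (f (fps_nth (fps_const a) j) (fps_nth (fps_const b) (l - j))) i)
      = (if l = 0 then fps_nth (f a b) i else 0)" for l i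
    by (cases "l = 0") (auto intro!: sum.neutral simp: assms)
  have "fps_nth (fps_lift2 f (fps_const a) (fps_const b)) n =
      (\<Sum>i\<le>n. if i = n then fps_nth (f a b) n else 0)"
    unfolding fps_lift2_def fps_series2_def fps_hom_ext2_def fps_nth_Abs_fps *
    by (intro sum.cong refl) auto
  then show "fps_nth (fps_lift2 f (fps_const a) (fps_const b)) n = fps_nth (f a b) n" by simp
qed

lemma qp_twist_t0_0: "qp_twist_t0 0 = 0"
  by (simp add: qp_twist_t0_def qp_twist_gen_def qp_fps_scale_0)

lemma qp_mult_0: "qp_mult q 0 b = 0" "qp_mult q a 0 = 0"
proof -
  have "((\<lambda>p. pcompose p [:0, q:]) ^^ i) 0 = 0" for i by (induction i) simp_all
  then show "qp_mult q 0 b = 0" "qp_mult q a 0 = 0"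
    by (simp_all add: qp_mult_def ore_mult_def)
qed

lemma qp_twist_t_basis:
  "qp_twist_t (fps_const (qp_basis m n)) =
     fps_scale qp_scale ((1 + fps_X) ^ m) (fps_const (qp_basis m n))"
proof -
  have "qp_twist_t0 (qp_basis m n) = fps_scale qp_scale ((1 + fps_X) ^ m) (fps_const (qp_basis m n))"
    unfolding qp_twist_t0_def
    by (rule qp_twist_gen_basis) (simp_all add: qp_fps_scale_0 qp_fps_scale_1)
  then show ?thesis by (simp add: qp_twist_t_def fps_lift_const qp_twist_t0_0)
qed

lemma hqp_mult_t_const:
  "hqp_mult_t q (fps_const a) (fps_const b) = qp_twist_t (fps_const (qp_mult q a b))"
  by (simp add: hqp_mult_t_def qp_twist_t_def fps_lift_const fps_lift2_const qp_twist_t0_0 qp_mult_0)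

end

theory Submission
  imports Defs
begin

text \<open>
  On the basis, \<open>\<alpha>\<^sub>t (y ^ m * x ^ n) = (1 + t) ^ m * (y ^ m * x ^ n)\<close>, so the coefficient of \<open>t ^ i\<close>
  in \<open>\<alpha>\<^sub>t\<close> is the diagonal map with entries \<open>m choose i\<close>. Vandermonde's identity turns this into
  multiplicativity: \<open>\<alpha>\<^sub>t\<close> is an endomorphism of the associative algebra of power series over the
  quantum plane. Yau's twisting principle then applies: since
  \<open>[\<alpha> u, [v, w]\<^sub>\<alpha>]\<^sub>\<alpha> = \<alpha> (\<alpha> [u, [v, w]])\<close>, the hom-Jacobi identity is the image under \<open>\<alpha>\<close> applied
  twice of the ordinary Jacobi identity.
\<close>

section \<open>Twisting an associative algebra by an endomorphism\<close>

lemma module_bilinearD: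
  assumes "module_bilinear s f"
  shows "module s"
    and "f (a + b) c = f a c + f b c" and "f a (b + c) = f a b + f a c"
    and "f (s r a) b = s r (f a b)" and "f a (s r b) = s r (f a b)"
    and "additive (f a)" and "additive (\<lambda>a. f a b)"
proof -
  have l: "module_hom s s (\<lambda>v. f u v)" and r: "module_hom s s (\<lambda>u. f u v)" for u v
    using assms by (auto simp: module_bilinear_def)
  show "module s"
    using l by (simp add: module_hom_def)
  show "f (a + b) c = f a c + f b c" "f (s r a) b = s r (f a b)" for a b
    by (simp_all add: module_hom.add[OF r] module_hom.scale[OF r])
  then show "additive (\<lambda>a. f a b)" by (simp add: additive_def module_hom.add[OF r])
  show "f a (b + c) = f a b + f a c" "f a (s r b) = s r (f a b)" for b c
    by (simp_all add: module_hom.add[OF l] module_hom.scale[OF l])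
  then show "additive (f a)" by (simp add: additive_def module_hom.add[OF l])
qed

lemma module_bilinearI:
  assumes "module s"
    and "\<And>a b c. f (a + b) c = f a c + f b c" and "\<And>a b c. f a (b + c) = f a b + f a c"
    and "\<And>r a b. f (s r a) b = s r (f a b)" and "\<And>r a b. f a (s r b) = s r (f a b)"
  shows "module_bilinear s f"
  using assms by (auto simp: module_bilinear_def module_hom_def module_hom_axioms_def)

lemma module_bilinear_commutator_comp:
  assumes f: "module_bilinear s f" and g: "module_hom s s g"
  shows "module_bilinear s (commutator (\<lambda>a b. g (f a b)))"
  by (rule module_bilinearI)
    (simp_all add: commutator_def module_bilinearD[OF f] module_hom.add[OF g] module_hom.scale[OF g]
      module.scale_right_diff_distrib[OF module_bilinearD(1)[OF f]])

lemma hom_lie_algebra_twisted_commutator: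
  assumes f: "module_bilinear s f" and tw: "module_hom s s tw"
    and assoc: "\<And>a b c. f (f a b) c = f a (f b c)"
    and mult: "\<And>a b. tw (f a b) = f (tw a) (tw b)"
  shows "hom_lie_algebra s (commutator (\<lambda>a b. tw (f a b))) tw"
proof -
  let ?br = "commutator (\<lambda>a b. tw (f a b))"
  note diff = additive.diff[OF module_bilinearD(6)[OF f]] additive.diff[OF module_bilinearD(7)[OF f]]
    module_hom.diff[OF tw]
  \<comment> \<open>Multiplicativity moves every \<open>tw\<close> onto the variables and
    associativity brackets to the right, leaving the four monomials of \<open>[u, [v, w]]\<close>.
    In the cyclic sum each of the six orderings of \<open>u\<close>, \<open>v\<close>,
    \<open>w\<close> occurs twice, with opposite signs.\<close>
  have "?br (tw u) (?br v w) = tw (tw (f u (f v w) - f u (f w v) - f v (f w u) + f w (f v u)))"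
    for u v w
    by (simp add: commutator_def diff mult assoc module_hom.add[OF tw])
  then have "?br (tw u) (?br v w) + ?br (tw w) (?br u v) + ?br (tw v) (?br w u) = 0" for u v w
    by (simp add: diff module_hom.add[OF tw])
  then show ?thesis
    using module_bilinear_commutator_comp[OF f tw] module_bilinearD(1)[OF f] tw
    by (auto simp: hom_lie_algebra_def hom_lie_algebra_axioms_def commutator_def)
qed


section \<open>Convolution of power series\<close>

text \<open>
  All operations on \<open>M[[t]]\<close> are convolutions; the series of maps \<open>\<Sum>i. f i * t ^ i\<close> is a
  convolution with the power series \<open>Abs_fps f\<close> of functions.
\<close>

definition fps_conv :: "('a \<Rightarrow> 'b \<Rightarrow> 'c::ab_group_add) \<Rightarrow> 'a fps \<Rightarrow> 'b fps \<Rightarrow> 'c fps"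
  where "fps_conv h u v = Abs_fps (\<lambda>n. \<Sum>j\<le>n. h (fps_nth u j) (fps_nth v (n - j)))"

lemma fps_conv_nth: "fps_nth (fps_conv h u v) n = (\<Sum>j\<le>n. h (fps_nth u j) (fps_nth v (n - j)))"
  by (simp add: fps_conv_def)

lemma fps_scale_eq_conv: "fps_scale s = fps_conv s"
  by (simp add: fun_eq_iff fps_scale_def fps_conv_def)

lemma fps_hom_ext2_eq_conv: "fps_hom_ext2 f = fps_conv f"
  by (simp add: fun_eq_iff fps_hom_ext2_def fps_conv_def)

lemma fps_series_eq_conv: "fps_series f = fps_conv (\<lambda>g. g) (Abs_fps f)"
  by (simp add: fun_eq_iff fps_series_def fps_hom_ext_def fps_conv_def)

lemma fps_conv_add_left:
  assumes "\<And>a b c. h (a + b) c = h a c + h b c"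
  shows "fps_conv h (u + u') v = fps_conv h u v + fps_conv h u' v"
  by (rule fps_ext) (simp add: fps_conv_nth assms sum.distrib)

text \<open>Additivity is asked of \<open>h\<close> only at the coefficients of \<open>u\<close>:
  when \<open>u\<close> is a series of maps and \<open>h\<close> is application, only those maps are
  known to be linear.\<close>

lemma fps_conv_add_right:
  assumes "\<And>j a b. h (fps_nth u j) (a + b) = h (fps_nth u j) a + h (fps_nth u j) b"
  shows "fps_conv h u (v + v') = fps_conv h u v + fps_conv h u v'"
  by (rule fps_ext) (simp add: fps_conv_nth assms sum.distrib)

lemma fps_conv_nested_nth:
  assumes "\<And>j. additive (h1 (fps_nth a j))"
  shows "fps_nth (fps_conv h1 a (fps_conv h2 b c)) n =
    (\<Sum>j\<le>n. \<Sum>i\<le>n - j. h1 (fps_nth a j) (h2 (fps_nth b i) (fps_nth c (n - j - i))))"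
  by (simp add: fps_conv_nth additive.sum[OF assms])

text \<open>Both sides sum over all index triples with total \<open>n\<close>. Allowing four
  different operations lets one statement yield the module law, the passage of scalars out of a left
  factor, and associativity of a product.\<close>

lemma fps_conv_assoc:
  assumes "\<And>c. additive (\<lambda>x. h1 x c)" and "\<And>a. additive (h3 a)"
    and "\<And>a b c. h1 (h2 a b) c = h3 a (h4 b c)"
  shows "fps_conv h1 (fps_conv h2 a b) c = fps_conv h3 a (fps_conv h4 b c)"
proof (rule fps_ext)
  fix n
  have "fps_nth (fps_conv h1 (fps_conv h2 a b) c) n =
      (\<Sum>j\<le>n. \<Sum>i\<le>j. h3 (fps_nth a i) (h4 (fps_nth b (j - i)) (fps_nth c (n - j))))"
    by (simp add: fps_conv_nth additive.sum[OF assms(1)] assms(3))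
  also have "\<dots> = (\<Sum>j\<le>n. \<Sum>i\<le>n - j. h3 (fps_nth a j) (h4 (fps_nth b i) (fps_nth c (n - j - i))))"
    using fps_mult_assoc_lemma[of "\<lambda>i j k. h3 (fps_nth a i) (h4 (fps_nth b j) (fps_nth c k))" n]
    by (simp add: atLeast0AtMost)
  finally show "fps_nth (fps_conv h1 (fps_conv h2 a b) c) n =
      fps_nth (fps_conv h3 a (fps_conv h4 b c)) n"
    by (simp add: fps_conv_nested_nth assms(2))
qed

text \<open>The same triple sum with the first two indices exchanged. It moves scalars out of the
  right factor of a product and out of the argument of a series of linear maps.\<close>

lemma fps_conv_left_commute:
  assumes "\<And>j. additive (h1 (fps_nth a j))" and "\<And>b. additive (h3 b)"
    and "\<And>j b c. h1 (fps_nth a j) (h2 b c) = h3 b (h4 (fps_nth a j) c)"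
  shows "fps_conv h1 a (fps_conv h2 b c) = fps_conv h3 b (fps_conv h4 a c)"
proof (rule fps_ext)
  fix n
  have "(\<Sum>j\<le>n. \<Sum>i\<le>n - j. h3 (fps_nth b i) (h4 (fps_nth a j) (fps_nth c (n - j - i)))) =
      (\<Sum>i\<le>n. \<Sum>j\<le>n - i. h3 (fps_nth b i) (h4 (fps_nth a j) (fps_nth c (n - i - j))))"
    by (simp add: sum.Sigma, intro sum.reindex_bij_witness[where i = prod.swap and j = prod.swap])
      (auto simp: add.commute)
  then show "fps_nth (fps_conv h1 a (fps_conv h2 b c)) n =
      fps_nth (fps_conv h3 b (fps_conv h4 a c)) n"
    by (simp add: fps_conv_nested_nth assms)
qed

section \<open>Module and product structure on power series\<close>

lemma module_fps_scale:
  assumes "module s"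
  shows "module (fps_scale s)"
proof -
  interpret module s by (rule assms)
  have mult: "a * b = fps_conv (*) a b" for a b :: "'a fps"
    by (rule fps_ext) (simp add: fps_conv_nth fps_mult_nth atLeast0AtMost)
  have one: "fps_conv s 1 v = v" for v
  proof (rule fps_ext)
    fix n
    have "fps_nth (fps_conv s 1 v) n = (\<Sum>j\<le>n. if j = 0 then fps_nth v n else 0)"
      unfolding fps_conv_nth by (intro sum.cong) auto
    then show "fps_nth (fps_conv s 1 v) n = fps_nth v n" by simp
  qed
  show ?thesis
    unfolding fps_scale_eq_conv
  proof
    show "fps_conv s a (fps_conv s b x) = fps_conv s (a * b) x" for a b x
      unfolding mult
      by (rule fps_conv_assoc[symmetric])
        (simp_all add: additive_def scale_left_distrib scale_right_distrib)
  qed (simp_all add: one fps_conv_add_left fps_conv_add_right scale_left_distrib scale_right_distrib)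
qed

lemma module_bilinear_fps_hom_ext2:
  assumes f: "module_bilinear s f"
  shows "module_bilinear (fps_scale s) (fps_hom_ext2 f)"
proof -
  note D = module_bilinearD[OF f]
  interpret module s by (rule D)
  show ?thesis
  proof (rule module_bilinearI)
    show "module (fps_scale s)" by (rule module_fps_scale) (rule D)
    show "fps_hom_ext2 f (fps_scale s r a) b = fps_scale s r (fps_hom_ext2 f a b)" for r a b
      unfolding fps_scale_eq_conv fps_hom_ext2_eq_conv
      by (rule fps_conv_assoc) (simp_all add: D additive_def scale_right_distrib)
    show "fps_hom_ext2 f a (fps_scale s r b) = fps_scale s r (fps_hom_ext2 f a b)" for r a b
      unfolding fps_scale_eq_conv fps_hom_ext2_eq_conv
      by (rule fps_conv_left_commute) (simp_all add: D additive_def scale_right_distrib)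
  qed (simp_all add: fps_hom_ext2_eq_conv fps_conv_add_left fps_conv_add_right D)
qed

lemma fps_hom_ext2_assoc:
  assumes "module_bilinear s f" and "\<And>a b c. f (f a b) c = f a (f b c)"
  shows "fps_hom_ext2 f (fps_hom_ext2 f u v) w = fps_hom_ext2 f u (fps_hom_ext2 f v w)"
  unfolding fps_hom_ext2_eq_conv
  by (rule fps_conv_assoc) (simp_all add: module_bilinearD[OF assms(1)] assms(2))

section \<open>Series of linear maps and of bilinear operations\<close>

lemma module_hom_fps_series:
  assumes g: "\<And>i. module_hom s s (g i)"
  shows "module_hom (fps_scale s) (fps_scale s) (fps_series g)"
proof -
  have s: "module s" using g by (simp add: module_hom_def)
  interpret module s by (rule s)
  show ?thesis
  proof (intro module_hom.intro module_hom_axioms.intro module_fps_scale s)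
    show "fps_series g (fps_scale s r b) = fps_scale s r (fps_series g b)" for r b
      unfolding fps_scale_eq_conv fps_series_eq_conv
      by (rule fps_conv_left_commute)
        (simp_all add: additive_def scale_right_distrib module_hom.add[OF g] module_hom.scale[OF g])
  qed (simp add: fps_series_eq_conv fps_conv_add_right module_hom.add[OF g])
qed

text \<open>Makes the rule
  \<open>a \<cdot>\<^sub>t b = \<alpha>\<^sub>t (a \<cdot>\<^sub>0 b)\<close> available for all
  power series, not only for constant ones: linearity lets each \<open>g i\<close> pass through the
  convolution sum.\<close>

lemma fps_series_comp_hom_ext2:
  assumes "\<And>i. module_hom s s (g i)"
  shows "fps_series g (fps_hom_ext2 f u v) = fps_series2 (\<lambda>i a b. g i (f a b)) u v"
  by (rule fps_ext)
    (simp add: fps_series_def fps_hom_ext_def fps_series2_def fps_hom_ext2_def module_hom.sum[OF assms])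

text \<open>Hypothesis \<open>mult\<close> is the higher Leibniz rule, as for Hasse-Schmidt
  derivations; it makes the generating series of the maps multiplicative.\<close>

lemma fps_series_hom_ext2_mult:
  assumes f: "module_bilinear s f" and g: "\<And>i. module_hom s s (g i)"
    and mult: "\<And>n a b. g n (f a b) = (\<Sum>i\<le>n. f (g i a) (g (n - i) b))"
  shows "fps_series g (fps_hom_ext2 f u v) = fps_hom_ext2 f (fps_series g u) (fps_series g v)"
proof (rule fps_ext)
  fix n :: nat
  note D = module_bilinearD[OF f]
  \<comment> \<open>Both sets describe the splittings of \<open>n\<close> into two map indices and
    two coefficient indices: \<open>?S\<close> fixes the sum of the map indices first,
    \<open>?T\<close> the total degree of the left factor.\<close>
  let ?S = "SIGMA i:{..n}. {..n - i} \<times> {..i}"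
  let ?T = "SIGMA j:{..n}. {..j} \<times> {..n - j}"
  have "fps_nth (fps_series g (fps_hom_ext2 f u v)) n =
      (\<Sum>i\<le>n. \<Sum>j\<le>n - i. \<Sum>p\<le>i. f (g p (fps_nth u j)) (g (i - p) (fps_nth v (n - i - j))))"
    by (simp add: fps_series_def fps_hom_ext_def fps_hom_ext2_def module_hom.sum[OF g] mult)
  also have "\<dots> = (\<Sum>(i, j, p)\<in>?S. f (g p (fps_nth u j)) (g (i - p) (fps_nth v (n - i - j))))"
    by (simp add: sum.Sigma sum.cartesian_product split_beta)
  also have "\<dots> = (\<Sum>(j, i, r)\<in>?T. f (g i (fps_nth u (j - i))) (g r (fps_nth v (n - j - r))))"
    by (rule sum.reindex_bij_witness[where
          i = "\<lambda>(j, i, r). (i + r, j - i, i)" and j = "\<lambda>(i, j, p). (p + j, p, i - p)"])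
      (auto simp: algebra_simps)
  also have "\<dots> = (\<Sum>j\<le>n. \<Sum>i\<le>j. \<Sum>r\<le>n - j. f (g i (fps_nth u (j - i))) (g r (fps_nth v (n - j - r))))"
    by (simp add: sum.Sigma sum.cartesian_product split_beta)
  also have "\<dots> = fps_nth (fps_hom_ext2 f (fps_series g u) (fps_series g v)) n"
    by (simp add: fps_series_def fps_hom_ext_def fps_hom_ext2_def
        additive.sum[OF D(6)] additive.sum[OF D(7)], intro sum.cong refl sum.swap)
  finally show "fps_nth (fps_series g (fps_hom_ext2 f u v)) n =
      fps_nth (fps_hom_ext2 f (fps_series g u) (fps_series g v)) n" .
qed

text \<open>Gives the deformed commutator the form demanded of a deformed bracket. Reversing the
  index of the inner convolution aligns the swapped product.\<close>

lemma commutator_fps_series2: "commutator (fps_series2 g) = fps_series2 (\<lambda>i. commutator (g i))"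
proof (intro ext fps_ext)
  fix u v n
  have "(\<Sum>j\<le>m. g i (fps_nth v j) (fps_nth u (m - j))) = (\<Sum>j\<le>m. g i (fps_nth v (m - j)) (fps_nth u j))"
    for i m
    by (rule sum.reindex_bij_witness[where i = "\<lambda>j. m - j" and j = "\<lambda>j. m - j"]) auto
  then show "fps_nth (commutator (fps_series2 g) u v) n = fps_nth (fps_series2 (\<lambda>i. commutator (g i)) u v) n"
    by (simp add: commutator_def fps_series2_def fps_hom_ext2_def sum_subtractf)
qed


section \<open>Multiplication in Ore extensions\<close>

text \<open>Reduces identities additive in each argument to monomials, where
  \<open>ore_mult_monom\<close> gives a closed form.\<close>

lemma poly_monom_add_induct [case_names monom add]:
  assumes "\<And>c n. P (monom c n)" and "\<And>p q. P p \<Longrightarrow> P q \<Longrightarrow> P (p + q)"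
  shows "P p"
proof -
  have "P (\<Sum>i\<in>A. monom (coeff p i) i)" if "finite A" for A
    \<comment> \<open>The empty sum needs \<open>P 0\<close>, obtained from
      \<open>monom 0 0 = 0\<close>.\<close>
    using that assms(1)[of 0 0] by (induction A) (simp_all add: assms)
  from this[of "{..degree p}"] show ?thesis
    by (simp add: poly_as_sum_of_monoms)
qed

lemma additive_funpow:
  fixes \<sigma> :: "'a::ab_group_add \<Rightarrow> 'a"
  assumes "additive \<sigma>"
  shows "additive (\<sigma> ^^ n)"
  by (induction n) (simp_all add: additive_def additive.add[OF assms])

text \<open>A sum and its summands may differ in degree, so their products are defined by sums over
  different ranges; common bounds make additivity a termwise matter.\<close>

lemma ore_mult_eq_sum:
  assumes "additive \<sigma>" and "degree a \<le> N" and "degree b \<le> M"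
  shows "ore_mult \<sigma> a b = (\<Sum>i\<le>N. \<Sum>j\<le>M. monom (coeff a i * (\<sigma> ^^ i) (coeff b j)) (i + j))"
proof -
  have "(\<Sum>j\<le>degree b. monom (coeff a i * (\<sigma> ^^ i) (coeff b j)) (i + j)) =
      (\<Sum>j\<le>M. monom (coeff a i * (\<sigma> ^^ i) (coeff b j)) (i + j))" for i
    using assms
    by (intro sum.mono_neutral_left) (auto simp: coeff_eq_0 additive.zero[OF additive_funpow])
  moreover have "(\<Sum>i\<le>degree a. \<Sum>j\<le>M. monom (coeff a i * (\<sigma> ^^ i) (coeff b j)) (i + j)) =
      (\<Sum>i\<le>N. \<Sum>j\<le>M. monom (coeff a i * (\<sigma> ^^ i) (coeff b j)) (i + j))"
    using assms by (intro sum.mono_neutral_left) (auto simp: coeff_eq_0)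
  ultimately show ?thesis by (simp add: ore_mult_def)
qed

lemma ore_mult_add_left:
  assumes "additive \<sigma>"
  shows "ore_mult \<sigma> (a + b) c = ore_mult \<sigma> a c + ore_mult \<sigma> b c"
proof -
  let ?N = "max (degree a) (degree b)"
  have "degree (a + b) \<le> ?N" by (rule degree_add_le_max)
  then show ?thesis
    using ore_mult_eq_sum[OF assms _ order_refl, where N = ?N and b = c]
    by (simp add: distrib_right sum.distrib flip: add_monom)
qed

lemma ore_mult_add_right:
  assumes "additive \<sigma>"
  shows "ore_mult \<sigma> a (b + c) = ore_mult \<sigma> a b + ore_mult \<sigma> a c"
proof -
  let ?N = "max (degree b) (degree c)"
  have "degree (b + c) \<le> ?N" by (rule degree_add_le_max)
  then show ?thesis
    using ore_mult_eq_sum[OF assms order_refl, where M = ?N and a = a]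
    by (simp add: distrib_left sum.distrib additive.add[OF additive_funpow[OF assms]] flip: add_monom)
qed

lemma ore_mult_smult_left:
  assumes "additive \<sigma>"
  shows "ore_mult \<sigma> (smult c a) b = smult c (ore_mult \<sigma> a b)"
proof -
  note ore_monom = ore_mult_monom[of \<sigma>, OF additive.zero[OF assms]]
  show ?thesis
  proof (induction a rule: poly_monom_add_induct)
    case (monom d i)
    show ?case
      by (induction b rule: poly_monom_add_induct)
        (simp_all add: smult_monom ore_monom mult.assoc ore_mult_add_right[OF assms] smult_add_right)
  qed (simp add: ore_mult_add_left[OF assms] smult_add_right)
qed

text \<open>A scalar leaves the right factor by passing powers of \<open>x\<close>, that is, under
  iterates of \<sigma>, which fix it. Constants in \<open>K\<close> are fixed by the substitution of
  \<open>q * y\<close> for \<open>y\<close>.\<close>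

lemma ore_mult_smult_right:
  assumes "additive \<sigma>" and "\<And>a b. \<sigma> (a * b) = \<sigma> a * \<sigma> b" and "\<sigma> c = c"
  shows "ore_mult \<sigma> a (smult c b) = smult c (ore_mult \<sigma> a b)"
proof -
  note ore_monom = ore_mult_monom[of \<sigma>, OF additive.zero[OF assms(1)]]
  have "(\<sigma> ^^ i) (c * b) = c * (\<sigma> ^^ i) b" for i b
    by (induction i) (simp_all add: assms(2,3))
  note ore_monom = ore_monom this
  show ?thesis
  proof (induction a rule: poly_monom_add_induct)
    case (monom d i)
    show ?case
      by (induction b rule: poly_monom_add_induct)
        (simp_all add: smult_monom ore_monom mult.left_commute ore_mult_add_right[OF assms(1)] smult_add_right)
  qed (simp add: ore_mult_add_left[OF assms(1)] smult_add_right)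
qed

text \<open>On monomials with coefficients \<open>x\<close>, \<open>y\<close>, \<open>z\<close> both
  sides have coefficient \<open>x * (\<sigma> ^^ i) y * (\<sigma> ^^ (i + j)) z\<close>, because
  iterates of \<sigma> are multiplicative.\<close>

lemma ore_mult_assoc:
  assumes "additive \<sigma>" and "\<And>a b. \<sigma> (a * b) = \<sigma> a * \<sigma> b"
  shows "ore_mult \<sigma> (ore_mult \<sigma> a b) c = ore_mult \<sigma> a (ore_mult \<sigma> b c)"
proof -
  note ore_monom = ore_mult_monom[of \<sigma>, OF additive.zero[OF assms(1)]]
  note add = ore_mult_add_left[OF assms(1)] ore_mult_add_right[OF assms(1)]
  have pow: "(\<sigma> ^^ i) (x * y) = (\<sigma> ^^ i) x * (\<sigma> ^^ i) y" for i x y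
    by (induction i) (simp_all add: assms(2))
  show ?thesis
  proof (induction a rule: poly_monom_add_induct)
    case a: (monom x i)
    show ?case
    proof (induction b rule: poly_monom_add_induct)
      case b: (monom y j)
      show ?case
        by (induction c rule: poly_monom_add_induct)
          (simp_all add: ore_monom pow add funpow_add mult.assoc add.assoc)
    qed (simp add: add)
  qed (simp add: add)
qed


section \<open>The quantum plane\<close>

lemma additive_pcompose: "additive (\<lambda>p. pcompose p r)"
  by (simp add: additive_def pcompose_add)

lemma module_qp_scale: "module qp_scale"
proof
  show "qp_scale a (qp_scale b x) = qp_scale (a * b) x" for a b and x :: "'a poly poly"
    by (simp add: qp_scale_def mult.commute)
qed (simp_all add: qp_scale_def smult_add_right flip: smult_add_left one_pCons)

lemma module_bilinear_qp_mult: "module_bilinear qp_scale (qp_mult q)"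
  unfolding qp_mult_def qp_scale_def
  by (rule module_bilinearI)
    (simp_all add: module_qp_scale[unfolded qp_scale_def] ore_mult_add_left ore_mult_add_right
      ore_mult_smult_left ore_mult_smult_right additive_pcompose pcompose_mult)

lemma qp_mult_assoc: "qp_mult q (qp_mult q a b) c = qp_mult q a (qp_mult q b c)"
  unfolding qp_mult_def by (rule ore_mult_assoc) (simp_all add: additive_pcompose pcompose_mult)

lemma qp_mult_monom:
  "qp_mult q (monom (monom c m) n) (monom (monom d m') n') =
    monom (monom (c * d * q ^ (n * m')) (m + m')) (n + n')"
  by (simp add: qp_mult_def ore_mult_monom qp_pcompose_iter_monom mult_monom mult.assoc)

lemma qp_induct [case_names monom add]:
  assumes "\<And>c m n. P (monom (monom c m) n)" and "\<And>a b. P a \<Longrightarrow> P b \<Longrightarrow> P (a + b)"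
  shows "P a"
proof (induction a rule: poly_monom_add_induct)
  case (monom p n)
  show ?case
    by (induction p rule: poly_monom_add_induct) (simp_all add: assms flip: add_monom)
qed (rule assms)

section \<open>Binomial coefficients of the twisting map\<close>

lemma fps_nth_one_plus_X_power:
  "fps_nth ((1 + fps_X) ^ m) i = (of_nat (m choose i) :: 'a::comm_ring_1)"
proof (induction m arbitrary: i)
  case (Suc m)
  then show ?case
    by (cases i) (simp_all add: distrib_right)
next
  case 0
  show ?case by (cases i) simp_all
qed

text \<open>This is the map \<open>\<alpha>\<^sub>i\<close> of the deformation: \<open>y ^ i\<close>
  times the \<open>i\<close>-th Hasse derivative in \<open>y\<close>.\<close>

definition qp_twist_coeff :: "nat \<Rightarrow> 'k::field poly poly \<Rightarrow> 'k poly poly"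
  where "qp_twist_coeff i a = fps_nth (qp_twist_t0 a) i"

lemma coeff_qp_twist_coeff:
  "coeff (coeff (qp_twist_coeff i a) n) m = of_nat (m choose i) * coeff (coeff a n) m"
proof -
  have const: "fps_nth (fps_scale qp_scale (fps_const c) v) i = qp_scale c (fps_nth v i)"
    for c :: 'a and v i
  proof -
    have "fps_nth (fps_scale qp_scale (fps_const c) v) i =
        (\<Sum>j\<le>i. if j = 0 then qp_scale c (fps_nth v i) else 0)"
      unfolding fps_scale_def fps_nth_Abs_fps by (intro sum.cong) (auto simp: qp_scale_def)
    then show ?thesis by simp
  qed
  have scale: "fps_nth (fps_scale qp_scale r (fps_const b)) i = qp_scale (fps_nth r i) b"
    for r :: "'a fps" and b i
  proof -
    have "fps_nth (fps_scale qp_scale r (fps_const b)) i =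
        (\<Sum>j\<le>i. if j = i then qp_scale (fps_nth r i) b else 0)"
      unfolding fps_scale_def fps_nth_Abs_fps by (intro sum.cong) (auto simp: qp_scale_def)
    then show ?thesis by simp
  qed
  let ?c = "of_nat (m choose i) * coeff (coeff a n) m"
  have "coeff (coeff (qp_twist_coeff i a) n) m =
      (\<Sum>n'\<le>degree a. \<Sum>m'\<le>degree (coeff a n'). if n' = n \<and> m' = m then ?c else 0)"
    unfolding qp_twist_coeff_def qp_twist_t0_def qp_twist_gen_def fps_sum_nth coeff_sum const scale
    by (intro sum.cong refl) (auto simp: qp_scale_def qp_basis_def fps_nth_one_plus_X_power)
  \<comment> \<open>Indices beyond the summation ranges are harmless: there the coefficient of
    \<open>a\<close>, hence \<open>?c\<close>, is zero.\<close>
  also have "\<dots> = (\<Sum>n'\<le>degree a. if n' = n then ?c else 0)"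
    by (intro sum.cong refl) (auto simp: sum.delta coeff_eq_0)
  also have "\<dots> = ?c"
    by (auto simp: coeff_eq_0)
  finally show ?thesis .
qed

lemma qp_twist_coeff_0: "qp_twist_coeff 0 = id"
  by (simp add: fun_eq_iff poly_eq_iff coeff_qp_twist_coeff)

lemma module_hom_qp_twist_coeff: "module_hom qp_scale qp_scale (qp_twist_coeff i)"
  by (intro module_hom.intro module_hom_axioms.intro module_qp_scale poly_eqI)
    (simp_all add: coeff_qp_twist_coeff qp_scale_def distrib_left)

lemma qp_twist_coeff_monom:
  "qp_twist_coeff i (monom (monom c m) n) = monom (monom (of_nat (m choose i) * c) m) n"
  by (intro poly_eqI) (simp add: coeff_qp_twist_coeff)

text \<open>For monomials the exponents of \<open>y\<close> add and the same power of
  \<open>q\<close> appears on both sides, so only Vandermonde's identity remains. This is the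
  Leibniz rule that \<open>fps_series_hom_ext2_mult\<close> asks for.\<close>

lemma qp_twist_coeff_mult:
  "qp_twist_coeff n (qp_mult q a b) = (\<Sum>i\<le>n. qp_mult q (qp_twist_coeff i a) (qp_twist_coeff (n - i) b))"
proof -
  note add = module_bilinearD(2,3)[OF module_bilinear_qp_mult[of q]] module_hom.add[OF module_hom_qp_twist_coeff]
  have monom_sum: "(\<Sum>i\<in>A. monom (g i) k) = monom (\<Sum>i\<in>A. g i) k"
    for g :: "nat \<Rightarrow> 'b::comm_monoid_add" and A k
    by (rule poly_eqI) (simp add: coeff_sum)
  show ?thesis
  proof (induction a rule: qp_induct)
    case a: (monom c m k)
    show ?case
    proof (induction b rule: qp_induct)
      case b: (monom d m' k')
      have "of_nat (m + m' choose n) = (\<Sum>i\<le>n. of_nat (m choose i) * of_nat (m' choose (n - i)) :: 'a)"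
        by (simp flip: vandermonde)
      then show ?case
        by (simp add: qp_mult_monom qp_twist_coeff_monom monom_sum sum_distrib_left sum_distrib_right mult_ac)
    qed (simp add: add sum.distrib)
  qed (simp add: add sum.distrib)
qed

theorem proposition6:
  fixes q :: "'k::field_char_0"
  assumes "q \<noteq> 0"
  shows "formal_hom_lie_deformation qp_scale (commutator (qp_mult q)) id
           (commutator (hqp_mult_t q)) qp_twist_t"
proof -
  let ?s = "qp_scale :: 'k \<Rightarrow> 'k poly poly \<Rightarrow> _"
  let ?br = "\<lambda>i. commutator (\<lambda>a b. qp_twist_coeff i (qp_mult q a b))"
  note bil = module_bilinear_qp_mult[of q] and hom = module_hom_qp_twist_coeff
  have twist: "qp_twist_t = fps_series qp_twist_coeff"
    by (simp add: qp_twist_t_def fps_lift_def qp_twist_coeff_def[abs_def])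
  have mult: "hqp_mult_t q = fps_series2 (\<lambda>i a b. qp_twist_coeff i (qp_mult q a b))"
    by (simp add: hqp_mult_t_def fps_lift2_def qp_twist_coeff_def)
  \<comment> \<open>The undeformed Lie algebra is the twist by the identity; the explicit
    \<open>id\<close> gives the bracket the shape of the twisting lemma.\<close>
  have "hom_lie_algebra ?s (commutator (\<lambda>a b. id (qp_mult q a b))) id"
    by (rule hom_lie_algebra_twisted_commutator[OF bil])
      (simp_all add: qp_mult_assoc module_hom_def module_hom_axioms_def module_qp_scale)
  \<comment> \<open>The same lemma over \<open>K[[t]]\<close>, applied to the homogeneously extended
    product.\<close>
  moreover have "hom_lie_algebra (fps_scale ?s)
      (commutator (\<lambda>u v. qp_twist_t (fps_hom_ext2 (qp_mult q) u v))) qp_twist_t"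
    unfolding twist
    by (intro hom_lie_algebra_twisted_commutator module_bilinear_fps_hom_ext2 bil
        module_hom_fps_series hom fps_hom_ext2_assoc[OF bil] fps_series_hom_ext2_mult[OF bil hom]
        qp_mult_assoc qp_twist_coeff_mult)
  moreover have "(\<lambda>u v. qp_twist_t (fps_hom_ext2 (qp_mult q) u v)) = hqp_mult_t q"
    by (simp add: fun_eq_iff twist mult fps_series_comp_hom_ext2[OF hom])
  moreover have "commutator (hqp_mult_t q) = fps_series2 ?br"
    by (simp add: mult commutator_fps_series2)
  moreover have "module_bilinear ?s (?br i)" for i
    by (rule module_bilinear_commutator_comp[OF bil hom])
  moreover have "?br 0 = commutator (qp_mult q)"
    by (simp add: qp_twist_coeff_0)
  ultimately show ?thesis
    unfolding formal_hom_lie_deformation_def using twist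
    by (intro conjI exI[of _ ?br] exI[of _ qp_twist_coeff]) (simp_all add: hom qp_twist_coeff_0)
qed

end
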